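(* For all natural numbers $k\le n$, letting $m=\mathcal{R}_1(n,k)$, $$m>(2\pi T_n)^{\frac{1}{4T_n}}\cdot\sqrt{\frac{2T_n}{e}}\cdot 2^{\frac{n^k-k^k}{2k^kT_n}}-1.$$
   Context: $T_n=n(n+1)/2$, $T_0=0$. A finite set $X\subseteq\mathbb{N}$ with $|X|=T_n$, enumerated $x_1<\dots<x_{T_n}$, has $i$-th level $\{x_{T_{i-1}+1},\dots,x_{T_i}\}$ for $1\le i\le n$; $\triangle_n$ is the set of all such sets. For such sets, $X\le Y$ means $X\subseteq Y$ and every level of $X$ is contained in a single level of $Y$, distinct levels of $X$ being contained in distinct levels of $Y$; $\triangle_k(B)=\{Z\in\triangle_k:Z\le B\}$. For natural numbers $k\le n$, a completed game of Mines$_m(n,k)$ is a partition $\triangle_k(B)=X\sqcup Y$ with $B\in\triangle_m$; it is a draw unless there is $Z\in\triangle_n(B)$ with $\triangle_k(Z)\subseteq X$ or $\triangle_k(Z)\subseteq Y$. $\mathcal{R}_1(n,k)$ is the least $m\ge n$ such that no completed game of Mines$_m(n,k)$ is a draw. *)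

theory Defs
  imports Complex_Main
begin

definition tri :: "nat \<Rightarrow> nat" where
  "tri n = n * (n + 1) div 2"

definition triangles :: "nat \<Rightarrow> nat set set" where
  "triangles n = {X. finite X \<and> card X = tri n}"

(* Levels are numbered from 1, but list positions start at 0: the elements
   x_(T_(i-1)+1), ..., x_(T_i) sit at positions T_(i-1), ..., T_i - 1.
   Only meaningful for X in triangles n and 1 <= i <= n. *)
definition level :: "nat set \<Rightarrow> nat \<Rightarrow> nat set" where
  "level X i = {sorted_list_of_set X ! j | j. tri (i - 1) \<le> j \<and> j < tri i}"

lemma strict_mono_tri: "strict_mono tri"
proof -
  have "tri (Suc n) = tri n + Suc n" for n
    proof -
    have "Suc n * (Suc n + 1) = n * (n + 1) + Suc n * 2"
      by (simp add: algebra_simps)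
    then show ?thesis
      unfolding tri_def by simp
  qed
  then show ?thesis
    by (simp add: strict_mono_Suc_iff)
qed

(* The numbers k and m of levels of X and Y are determined by the cardinalities,
   since tri is injective; f i is the level of Y containing the i-th level of X. *)
definition tri_le :: "nat set \<Rightarrow> nat set \<Rightarrow> bool" where
  "tri_le X Y \<longleftrightarrow>
     (\<exists>k m. X \<in> triangles k \<and> Y \<in> triangles m \<and> X \<subseteq> Y \<and>
        (\<exists>f. inj_on f {1..k} \<and>
           (\<forall>i\<in>{1..k}. f i \<in> {1..m} \<and> level X i \<subseteq> level Y (f i))))"

definition triangles_in :: "nat \<Rightarrow> nat set \<Rightarrow> nat set set" where
  "triangles_in k B = {Z \<in> triangles k. tri_le Z B}"

definition completed_game ::
    "nat \<Rightarrow> nat \<Rightarrow> nat set \<Rightarrow> nat set set \<Rightarrow> nat set set \<Rightarrow> bool" where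
  "completed_game m k B X Y \<longleftrightarrow>
     B \<in> triangles m \<and> X \<union> Y = triangles_in k B \<and> X \<inter> Y = {}"

definition draw ::
    "nat \<Rightarrow> nat \<Rightarrow> nat set \<Rightarrow> nat set set \<Rightarrow> nat set set \<Rightarrow> bool" where
  "draw n k B X Y \<longleftrightarrow>
     \<not> (\<exists>Z\<in>triangles_in n B. triangles_in k Z \<subseteq> X \<or> triangles_in k Z \<subseteq> Y)"

definition R1 :: "nat \<Rightarrow> nat \<Rightarrow> nat" where
  "R1 n k = (LEAST m. n \<le> m \<and>
     (\<forall>B X Y. completed_game m k B X Y \<longrightarrow> \<not> draw n k B X Y))"

end

(* The least m is attained, because Ramsey's theorem for sets of size T_(k+1) applies: a set of
   size T_(k+1) whose level i + 1 is {l < e_1 < ... < e_i} codes the k-triangle whose i-th level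
   consists of the places e_1, ..., e_i in the board level named by l. A homogeneous set of size
   T_(n+1) codes an n-triangle Z, and each k-triangle of Z is coded by a subset of that set.

   The lower bound is the first moment argument. Each Z contains N >= (n choose k) >= (n/k)^k
   triangles of size k, so a fraction at most 2^(1-N) of all colourings is constant on them. If
   every colouring is constant on some Z, then 2^(N-1) is at most the number of n-triangles in
   the board, hence at most T_m^(T_n) / T_n!. Stirling's lower bound for T_n! and
   2 T_m = m (m + 1) < (m + 1)^2 finish the proof. *)
theory Submission
  imports Defs "HOL-Library.Ramsey" "HOL-Analysis.Gamma_Function" "HOL-Real_Asymp.Real_Asymp"
begin

section \<open>Stirling's lower bound\<close>

text \<open>Both differences vanish at 0 and have a nonnegative derivative, a square over a positive
  denominator. At \<open>x = 1 / n\<close> the lower bound becomes exactly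
  \<open>1 / (n + 1/2)\<close>, and the upper bound times \<open>n + 1/2\<close> exceeds 1 by
  \<open>1 / (4 * n * (n + 1))\<close>, which telescopes.\<close>

lemma ln_add_one_bounds:
  fixes x :: real
  assumes "x \<ge> 0"
  shows "2 * x / (2 + x) \<le> ln (1 + x)" and "ln (1 + x) \<le> x * (2 + x) / (2 * (1 + x))"
proof -
  have "(\<lambda>x::real. ln (1 + x) - 2 * x / (2 + x)) 0 \<le> (\<lambda>x. ln (1 + x) - 2 * x / (2 + x)) x"
  proof (rule DERIV_nonneg_imp_nondecreasing[OF assms])
    fix t :: real assume "0 \<le> t"
    then have "((\<lambda>x. ln (1 + x) - 2 * x / (2 + x)) has_real_derivative
        1 / (1 + t) - (2 * (2 + t) - 2 * t) / ((2 + t) * (2 + t))) (at t)"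
      by (auto intro!: derivative_eq_intros)
    also have "1 / (1 + t) - (2 * (2 + t) - 2 * t) / ((2 + t) * (2 + t))
        = t^2 / ((1 + t) * (2 + t)^2)"
      using \<open>0 \<le> t\<close> by (simp add: divide_simps) (simp add: algebra_simps power2_eq_square)
    finally have "((\<lambda>x. ln (1 + x) - 2 * x / (2 + x)) has_real_derivative
        t^2 / ((1 + t) * (2 + t)^2)) (at t)" .
    moreover have "t^2 / ((1 + t) * (2 + t)^2) \<ge> 0"
      using \<open>0 \<le> t\<close> by simp
    ultimately show "\<exists>y. ((\<lambda>x. ln (1 + x) - 2 * x / (2 + x)) has_real_derivative y) (at t) \<and> 0 \<le> y"
      by blast
  qed
  then show "2 * x / (2 + x) \<le> ln (1 + x)" by simp
  have "(\<lambda>x::real. x * (2 + x) / (2 * (1 + x)) - ln (1 + x)) 0 \<le> (\<lambda>x. x * (2 + x) / (2 * (1 + x)) - ln (1 + x)) x"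
  proof (rule DERIV_nonneg_imp_nondecreasing[OF assms])
    fix t :: real assume "0 \<le> t"
    then have "((\<lambda>x. x * (2 + x) / (2 * (1 + x)) - ln (1 + x)) has_real_derivative
        ((2 + t + t) * (2 * (1 + t)) - t * (2 + t) * 2) / ((2 * (1 + t)) * (2 * (1 + t)))
          - 1 / (1 + t)) (at t)"
      by (auto intro!: derivative_eq_intros)
    also have "((2 + t + t) * (2 * (1 + t)) - t * (2 + t) * 2) / ((2 * (1 + t)) * (2 * (1 + t)))
          - 1 / (1 + t) = t^2 / (2 * (1 + t)^2)"
      using \<open>0 \<le> t\<close> by (simp add: divide_simps) (simp add: algebra_simps power2_eq_square)
    finally have "((\<lambda>x. x * (2 + x) / (2 * (1 + x)) - ln (1 + x)) has_real_derivative
        t^2 / (2 * (1 + t)^2)) (at t)" .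
    moreover have "t^2 / (2 * (1 + t)^2) \<ge> 0"
      by simp
    ultimately show "\<exists>y. ((\<lambda>x. x * (2 + x) / (2 * (1 + x)) - ln (1 + x)) has_real_derivative y) (at t) \<and> 0 \<le> y"
      by blast
  qed
  then show "ln (1 + x) \<le> x * (2 + x) / (2 * (1 + x))" by simp
qed

text \<open>The logarithm of \<open>n! / (sqrt n * (n / e)^n)\<close>. Stirling's lower bound says
  that it is at least \<open>ln (sqrt (2 * pi))\<close>.\<close>

definition stirling_error :: "nat \<Rightarrow> real" where
  "stirling_error n = ln (fact n) - (real n + 1/2) * ln (real n) + real n"

lemma stirling_error_diff:
  assumes "n > 0"
  shows "stirling_error n - stirling_error (Suc n) = (real n + 1/2) * ln (1 + 1 / real n) - 1"
proof -
  have "1 + 1 / real n = real (Suc n) / real n"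
    using assms by (simp add: field_simps)
  then have ln_Suc: "ln (real (Suc n)) = ln (real n) + ln (1 + 1 / real n)"
    using assms by (simp add: ln_div del: of_nat_Suc)
  have "ln (fact (Suc n) :: real) = ln (real (Suc n)) + ln (fact n)"
    by (simp add: ln_mult del: of_nat_Suc)
  then show ?thesis
    unfolding stirling_error_def ln_Suc by (simp add: field_simps)
qed

lemma stirling_error_antimono:
  assumes "n > 0"
  shows "stirling_error (Suc n) \<le> stirling_error n"
proof -
  have "1 = (real n + 1/2) * (2 * (1 / real n) / (2 + 1 / real n))"
    using assms by (simp add: field_simps)
  also have "\<dots> \<le> (real n + 1/2) * ln (1 + 1 / real n)"
    by (intro mult_left_mono ln_add_one_bounds) auto
  finally show ?thesis
    using stirling_error_diff[OF assms] by simp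
qed

text \<open>The correction term bounds \<^const>\<open>stirling_error\<close> from below, so that it converges;
  the limit is then determined by Wallis' product.\<close>
lemma stirling_error_lower_mono:
  assumes "n > 0"
  shows "stirling_error n - 1 / (4 * real n) \<le> stirling_error (Suc n) - 1 / (4 * real (Suc n))"
proof -
  have "(real n + 1/2) * ln (1 + 1 / real n)
      \<le> (real n + 1/2) * ((1 / real n) * (2 + 1 / real n) / (2 * (1 + 1 / real n)))"
    by (intro mult_left_mono ln_add_one_bounds) auto
  also have "\<dots> = 1 + 1 / (4 * real n) - 1 / (4 * real (Suc n))"
    using assms by (simp add: divide_simps) (simp add: algebra_simps)
  finally show ?thesis
    using stirling_error_diff[OF assms] by simp
qed

text \<open>A decreasing sequence that stays above the first term of its increasing corrected
  version converges. The shift by \<open>Suc\<close> skips index 0, where \<open>ln (real n)\<close>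
  is not a genuine logarithm.\<close>

lemma stirling_error_convergent: "convergent (\<lambda>n. stirling_error (Suc n))"
proof -
  have dec: "decseq (\<lambda>n. stirling_error (Suc n))"
    by (rule decseq_SucI) (simp add: stirling_error_antimono)
  have "incseq (\<lambda>n. stirling_error (Suc n) - 1 / (4 * real (Suc n)))"
    by (rule incseq_SucI) (rule stirling_error_lower_mono, simp)
  then have "stirling_error 1 - 1/4 \<le> stirling_error (Suc n) - 1 / (4 * real (Suc n))" for n
    unfolding incseq_def using le0[of n] by fastforce
  moreover have "0 \<le> 1 / (4 * real (Suc n))" for n by simp
  ultimately have low: "stirling_error 1 - 1/4 \<le> stirling_error (Suc n)" for n
    by (smt (verit))
  from decseq_convergent[OF dec, of "stirling_error 1 - 1/4"] low show ?thesis
    unfolding convergent_def by metis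
qed

text \<open>Since \<open>4 * k^2 - 1 = (2 * k - 1) * (2 * k + 1)\<close>, the product is the square
  of the product of all \<open>2 * k / (2 * k - 1)\<close>, divided by \<open>2 * n + 1\<close>.
  Inside the square stands \<open>4^n\<close> over the central binomial coefficient.\<close>

lemma wallis_prod_eq:
  "(\<Prod>k=1..n. (4 * real k^2) / (4 * real k^2 - 1)) =
     (4^n * (fact n)^2 / fact (2*n))^2 / (2 * real n + 1)"
proof (induction n)
  case 0
  then show ?case by simp
next
  case (Suc n)
  have "(\<Prod>k=1..Suc n. (4 * real k^2) / (4 * real k^2 - 1)) =
    (4^n * (fact n)^2 / fact (2*n))^2 / (2 * real n + 1) *
    ((4 * real (Suc n)^2) / ((2 * real n + 1) * (2 * real n + 3)))"
    using Suc by (simp add: algebra_simps power2_eq_square)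
  also have "\<dots> = (4 ^ n * (fact n)\<^sup>2 / fact (2 * n) *
     (4 * real (Suc n)^2 / ((2 * real n + 1) * (2 * real n + 2))))\<^sup>2 / (2 * real n + 3)"
    by (simp add: divide_simps del: fact_Suc) (simp add: algebra_simps power2_eq_square power4_eq_xxxx)
  also have "4 ^ n * (fact n)\<^sup>2 / fact (2 * n) *
      (4 * real (Suc n)^2 / ((2 * real n + 1) * (2 * real n + 2)))
      = 4 ^ Suc n * (fact (Suc n))\<^sup>2 / fact (2 * Suc n)"
  proof -
    have "(fact (2 * Suc n) :: real) = (2 * real n + 2) * (2 * real n + 1) * fact (2 * n)"
      by (simp add: algebra_simps)
    moreover have "(fact (Suc n) :: real) = real (Suc n) * fact n"
      by simp
    ultimately show ?thesis
      by (simp add: power_mult_distrib mult_ac del: fact_Suc)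
  qed
  finally show ?case by (simp add: algebra_simps)
qed

text \<open>The terms in \<open>n * ln n\<close> and \<open>n\<close> cancel in this combination.
  What remains of the factorials is \<open>4^n\<close> over the central binomial coefficient, hence
  a Wallis product.\<close>

lemma stirling_error_double:
  assumes "n > 0"
  shows "2 * stirling_error n - stirling_error (2 * n) =
    ln (2 * (\<Prod>k=1..n. (4 * real k^2) / (4 * real k^2 - 1)) * ((2 * real n + 1) / real n)) / 2"
proof -
  have "2 * (\<Prod>k=1..n. (4 * real k^2) / (4 * real k^2 - 1)) * ((2 * real n + 1) / real n)
     = 2 * ((4^n * (fact n)^2 / fact (2*n))^2 / real n)"
    unfolding wallis_prod_eq by simp
  also have "ln \<dots> = ln 2 + 2 * (real n * ln 4 + 2 * ln (fact n) - ln (fact (2*n))) - ln (real n)"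
    using assms by (simp add: ln_mult ln_div ln_realpow)
  also have "ln (4::real) = 2 * ln 2"
    using ln_realpow[of "2::real" 2] by simp
  finally show ?thesis
    using assms unfolding stirling_error_def by (simp add: ln_mult field_simps)
qed

text \<open>If \<open>L\<close> is the limit, the combination above tends to
  \<open>2 * L - L = L\<close> and, by Wallis, to half the logarithm of
  \<open>2 * (pi/2) * 2\<close>. A decreasing sequence lies above its limit.\<close>

lemma stirling_error_ge:
  assumes "n > 0"
  shows "ln (2 * pi) / 2 \<le> stirling_error n"
proof -
  obtain L where L': "(\<lambda>n. stirling_error (Suc n)) \<longlonglongrightarrow> L"
    using stirling_error_convergent by (auto simp: convergent_def)
  then have L: "stirling_error \<longlonglongrightarrow> L"
    by (rule LIMSEQ_imp_Suc)
  have "filterlim (\<lambda>n::nat. 2 * n) sequentially sequentially"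
    by real_asymp
  from filterlim_compose[OF L this]
  have "(\<lambda>n. 2 * stirling_error n - stirling_error (2 * n)) \<longlonglongrightarrow> 2 * L - L"
    by (intro tendsto_intros L)
  moreover have "(\<lambda>n. 2 * stirling_error n - stirling_error (2 * n)) \<longlonglongrightarrow> ln (2 * pi) / 2"
  proof (rule Lim_transform_eventually)
    have "(\<lambda>n. (2 * real n + 1) / real n) \<longlonglongrightarrow> 2" by real_asymp
    then have "(\<lambda>n. ln (2 * (\<Prod>k=1..n. (4 * real k^2) / (4 * real k^2 - 1)) * ((2 * real n + 1) / real n)) / 2)
       \<longlonglongrightarrow> ln (2 * (pi/2) * 2) / 2"
      by (intro tendsto_intros wallis) auto
    then show "(\<lambda>n. ln (2 * (\<Prod>k=1..n. (4 * real k^2) / (4 * real k^2 - 1)) * ((2 * real n + 1) / real n)) / 2)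
       \<longlonglongrightarrow> ln (2 * pi) / 2" by (simp add: mult.commute)
    show "\<forall>\<^sub>F n in sequentially. ln (2 * (\<Prod>k=1..n. (4 * real k^2) / (4 * real k^2 - 1)) * ((2 * real n + 1) / real n)) / 2
        = 2 * stirling_error n - stirling_error (2 * n)"
      using eventually_gt_at_top[of 0] by eventually_elim (simp only: stirling_error_double)
  qed
  ultimately have "L = ln (2 * pi) / 2"
    using LIMSEQ_unique by fastforce
  moreover have "decseq (\<lambda>n. stirling_error (Suc n))"
    by (rule decseq_SucI) (simp add: stirling_error_antimono)
  then have "L \<le> stirling_error (Suc (n - 1))"
    using L' decseq_ge by blast
  ultimately show ?thesis using assms by simp
qed

theorem stirling_lower_bound: "sqrt (2 * pi * real n) * (real n / exp 1) ^ n \<le> fact n"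
proof (cases "n = 0")
  case False
  then have n: "n > 0" by simp
  have "ln (sqrt (2 * pi * real n) * (real n / exp 1) ^ n) \<le> ln (fact n)"
    using stirling_error_ge[OF n] n unfolding stirling_error_def
    by (simp add: ln_mult ln_div ln_realpow ln_sqrt field_simps)
  then show ?thesis using n by (subst (asm) ln_le_cancel_iff) auto
qed simp

section \<open>Levels of triangles\<close>

lemma tri_0 [simp]: "tri 0 = 0"
  by (simp add: tri_def)

lemma tri_Suc: "tri (Suc n) = tri n + Suc n"
  unfolding tri_def by simp

lemma two_tri: "2 * tri n = n * (n + 1)"
  by (induction n) (auto simp: tri_Suc)

lemma le_tri: "n \<le> tri n"
  by (induction n) (auto simp: tri_Suc)

lemma tri_mono: "i \<le> j \<Longrightarrow> tri i \<le> tri j"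
  using strict_mono_tri by (simp add: strict_mono_less_eq)

lemma triangles_unique: "X \<in> triangles k \<Longrightarrow> X \<in> triangles l \<Longrightarrow> k = l"
  using strict_mono_eq[OF strict_mono_tri] by (auto simp: triangles_def)

lemma tri_pred_le: "1 \<le> i \<Longrightarrow> tri (i - 1) + i = tri i"
  by (cases i) (auto simp: tri_Suc)

lemma level_eq_image: "level X i = (!) (sorted_list_of_set X) ` {tri (i - 1)..<tri i}"
  by (auto simp: level_def)

lemma nth_sorted_list_of_set_less:
  "a < b \<Longrightarrow> b < card X \<Longrightarrow> sorted_list_of_set X ! a < sorted_list_of_set X ! b"
  by (simp add: sorted_wrt_nth_less[OF strict_sorted_list_of_set])

lemma set_nth_sorted_list_of_set:
  "finite X \<Longrightarrow> (!) (sorted_list_of_set X) ` {..<card X} = X"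
  by (metis length_sorted_list_of_set lessThan_atLeast0 list.set_map map_nth set_sorted_list_of_set set_upt)

lemma card_level:
  assumes "X \<in> triangles n" "i \<le> n"
  shows "card (level X i) = i"
\<comment> \<open>At \<open>i = 0\<close> truncated subtraction gives the empty interval from
  \<open>tri 0\<close> to \<open>tri 0\<close>.\<close>
proof (cases "i = 0")
  case False
  have "inj_on ((!) (sorted_list_of_set X)) {tri (i - 1)..<tri i}"
    using assms tri_mono[of i n] by (auto simp: inj_on_def triangles_def nth_eq_iff_index_eq)
  then show ?thesis
    using tri_pred_le[of i] False by (simp add: level_eq_image card_image)
qed (simp add: level_eq_image)

lemma finite_level [simp]: "finite (level X i)"
  by (simp add: level_eq_image)

lemma level_less:
  assumes "X \<in> triangles n" "i < j" "j \<le> n" "x \<in> level X i" "y \<in> level X j"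
  shows "x < y"
proof -
  from assms obtain a b where "a < tri i" "x = sorted_list_of_set X ! a"
    "tri (j - 1) \<le> b" "b < tri j" "y = sorted_list_of_set X ! b"
    by (auto simp: level_def)
  moreover have "tri i \<le> tri (j - 1)" "tri j \<le> tri n"
    using assms by (auto intro!: tri_mono)
  ultimately show ?thesis
    using assms(1) by (auto simp: triangles_def intro!: nth_sorted_list_of_set_less)
qed

lemma Union_tri_intervals: "(\<Union>i\<in>{1..n}. {tri (i - 1)..<tri i}) = {..<tri n}"
proof (induction n)
  case (Suc n)
  have "{1..Suc n} = insert (Suc n) {1..n}" by auto
  then show ?case using Suc tri_mono[of n "Suc n"] by auto
qed simp

lemma Union_level:
  assumes "X \<in> triangles n"
  shows "(\<Union>i\<in>{1..n}. level X i) = X"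
proof -
  have "(\<Union>i\<in>{1..n}. level X i) = (!) (sorted_list_of_set X) ` {..<tri n}"
    unfolding level_eq_image Union_tri_intervals[symmetric] by blast
  also have "\<dots> = X"
    using assms set_nth_sorted_list_of_set[of X] by (simp add: triangles_def)
  finally show ?thesis .
qed

lemma level_subset: "X \<in> triangles n \<Longrightarrow> i \<in> {1..n} \<Longrightarrow> level X i \<subseteq> X"
  using Union_level by blast

text \<open>The tool for building a triangle from prescribed levels. By induction on
  \<open>n\<close>: the last block lies above all earlier ones, so the sorted list of the union is a
  concatenation, and the positions from \<open>tri n\<close> on are those of the last block.\<close>

lemma blocks:
  fixes S :: "nat \<Rightarrow> nat set"
  assumes "\<And>i. i \<in> {1..n} \<Longrightarrow> card (S i) = i"
    and "\<And>i j x y. 1 \<le> i \<Longrightarrow> i < j \<Longrightarrow> j \<le> n \<Longrightarrow> x \<in> S i \<Longrightarrow> y \<in> S j \<Longrightarrow> x < y"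
  shows triangle_of_blocks: "(\<Union>i\<in>{1..n}. S i) \<in> triangles n"
    and level_of_blocks: "\<And>i. i \<in> {1..n} \<Longrightarrow> level (\<Union>i\<in>{1..n}. S i) i = S i"
proof -
  have "(\<Union>i\<in>{1..n}. S i) \<in> triangles n \<and> (\<forall>i\<in>{1..n}. level (\<Union>i\<in>{1..n}. S i) i = S i)"
    using assms
  proof (induction n)
    case 0
    then show ?case by (simp add: triangles_def)
  next
    case (Suc n)
    define U where "U = (\<Union>i\<in>{1..n}. S i)"
    define V where "V = S (Suc n)"
    have U: "U \<in> triangles n" "\<And>i. i \<in> {1..n} \<Longrightarrow> level U i = S i"
      unfolding U_def using Suc by auto
    have V: "card V = Suc n" "finite V"
      using Suc(2)[of "Suc n"] card_ge_0_finite[of V] unfolding V_def by auto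
    have less: "x < y" if "x \<in> U" "y \<in> V" for x y
      using that Suc(3)[of _ "Suc n"] unfolding U_def V_def by auto
    have UV: "(\<Union>i\<in>{1..Suc n}. S i) = U \<union> V"
      unfolding U_def V_def by (simp add: atLeastAtMostSuc_conv Un_commute)
    have "finite U" "card U = tri n" using U by (auto simp: triangles_def)
    moreover have "U \<inter> V = {}" using less by blast
    ultimately have card: "card (U \<union> V) = tri (Suc n)"
      using V by (simp add: card_Un_disjoint tri_Suc)
    have list: "sorted_list_of_set (U \<union> V) = sorted_list_of_set U @ sorted_list_of_set V"
      using less \<open>finite U\<close> V card
      by (subst sorted_list_of_set_unique[symmetric])
        (auto simp: sorted_wrt_append \<open>card U = tri n\<close> tri_Suc)
    have "level (U \<union> V) i = S i" if i: "i \<in> {1..Suc n}" for i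
    proof (cases "i = Suc n")
      case True
      have "{tri n..<tri (Suc n)} = (+) (tri n) ` {..<Suc n}"
        unfolding lessThan_atLeast0 image_add_atLeastLessThan by (simp add: tri_Suc add.commute)
      then have "level (U \<union> V) i = (\<lambda>j. sorted_list_of_set (U \<union> V) ! (tri n + j)) ` {..<Suc n}"
        unfolding level_eq_image True by (simp add: image_image)
      also have "\<dots> = (!) (sorted_list_of_set V) ` {..<card V}"
        using V \<open>card U = tri n\<close> unfolding list by (intro image_cong) (auto simp: nth_append)
      also have "\<dots> = V"
        using V(2) by (rule set_nth_sorted_list_of_set)
      finally show ?thesis using True V_def by simp
    next
      case False
      then have "i \<in> {1..n}" using i by auto
      then have "tri i \<le> tri n" by (auto intro: tri_mono)
      then have "level (U \<union> V) i = level U i"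
        using \<open>card U = tri n\<close> unfolding level_eq_image list
        by (intro image_cong) (auto simp: nth_append)
      then show ?thesis using U(2) \<open>i \<in> {1..n}\<close> by simp
    qed
    then show ?case
      unfolding UV using card \<open>finite U\<close> V by (auto simp: triangles_def)
  qed
  then show "(\<Union>i\<in>{1..n}. S i) \<in> triangles n"
    and "\<And>i. i \<in> {1..n} \<Longrightarrow> level (\<Union>i\<in>{1..n}. S i) i = S i" by auto
qed

section \<open>Triangles inside triangles\<close>

text \<open>Levels are ordered, so the injection in the definition of \<^const>\<open>tri_le\<close> is
  automatically increasing.\<close>
lemma triangles_in_iff:
  assumes B: "B \<in> triangles m"
  shows "Z \<in> triangles_in k B \<longleftrightarrow> Z \<in> triangles k \<and>
    (\<exists>f. strict_mono_on {1..k} f \<and> (\<forall>i\<in>{1..k}. f i \<in> {1..m} \<and> level Z i \<subseteq> level B (f i)))"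
    (is "?L \<longleftrightarrow> ?R")
proof
  assume ?L
  then have Z: "Z \<in> triangles k" and "tri_le Z B" by (auto simp: triangles_in_def)
  then obtain k' m' f where "Z \<in> triangles k'" "B \<in> triangles m'" and f: "inj_on f {1..k'}"
    "\<forall>i\<in>{1..k'}. f i \<in> {1..m'} \<and> level Z i \<subseteq> level B (f i)"
    unfolding tri_le_def by blast
  then have [simp]: "k' = k" "m' = m" using B Z triangles_unique by auto
  \<comment> \<open>Injectivity excludes equality. If \<open>f j < f i\<close>, then elements
    \<open>x\<close> of level \<open>i\<close> and \<open>y\<close> of level \<open>j\<close>
    satisfy \<open>x < y\<close> by the order of the levels of \<open>Z\<close>, but
    \<open>y < x\<close> by that of \<open>B\<close>.\<close>
  have "f i < f j" if "i \<in> {1..k}" "j \<in> {1..k}" "i < j" for i j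
  proof (rule ccontr)
    assume "\<not> f i < f j"
    moreover have "f i \<noteq> f j" using f(1) that by (auto dest: inj_onD)
    ultimately have "f j < f i" by simp
    have "level Z i \<noteq> {}" "level Z j \<noteq> {}"
      using card_level[OF Z, of i] card_level[OF Z, of j] that by auto
    then obtain x y where x: "x \<in> level Z i" and y: "y \<in> level Z j" by auto
    then have "x < y" using level_less[OF Z] that by auto
    moreover have "x \<in> level B (f i)" "y \<in> level B (f j)" "f i \<le> m"
      using f(2) that x y by auto
    then have "y < x" using level_less[OF B \<open>f j < f i\<close>] by auto
    ultimately show False by simp
  qed
  then show ?R using Z f(2) by (auto intro!: exI[of _ f] strict_mono_onI)
next
  assume ?R
  then obtain f where Z: "Z \<in> triangles k" and f: "strict_mono_on {1..k} f"
    "\<forall>i\<in>{1..k}. f i \<in> {1..m} \<and> level Z i \<subseteq> level B (f i)" by blast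
  then have "(\<Union>i\<in>{1..k}. level Z i) \<subseteq> B"
    using level_subset[OF B] by blast
  then have "Z \<subseteq> B" using Union_level[OF Z] by simp
  then show ?L
    using B Z f strict_mono_on_imp_inj_on[OF f(1)] unfolding triangles_in_def tri_le_def by blast
qed

lemma triangles_in_subset: "triangles_in k B \<subseteq> Pow B"
  by (auto simp: triangles_in_def tri_le_def)

text \<open>Level maps compose. Hence the \<open>k\<close>-triangles of an \<open>n\<close>-triangle
  on the board are themselves coloured by the game.\<close>

lemma triangles_in_trans:
  assumes B: "B \<in> triangles m" and Z: "Z \<in> triangles_in n B" and X: "X \<in> triangles_in k Z"
  shows "X \<in> triangles_in k B"
proof -
  obtain f where ZT: "Z \<in> triangles n" and f: "strict_mono_on {1..n} f"
    "\<forall>i\<in>{1..n}. f i \<in> {1..m} \<and> level Z i \<subseteq> level B (f i)"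
    using Z triangles_in_iff[OF B] by blast
  obtain g where "X \<in> triangles k" and g: "strict_mono_on {1..k} g"
    "\<forall>i\<in>{1..k}. g i \<in> {1..n} \<and> level X i \<subseteq> level Z (g i)"
    using X triangles_in_iff[OF ZT] by blast
  moreover have "strict_mono_on {1..k} (f \<circ> g)"
    using f(1) g by (auto simp: strict_mono_on_def)
  moreover have "\<forall>i\<in>{1..k}. (f \<circ> g) i \<in> {1..m} \<and> level X i \<subseteq> level B ((f \<circ> g) i)"
    using f(2) g(2) by fastforce
  ultimately show ?thesis using triangles_in_iff[OF B] by blast
qed

text \<open>Sets chosen in increasing levels of \<open>B\<close> inherit the order of those levels,
  so \<open>blocks\<close> applies. This produces the triangles needed for counting, for decoding
  and for lifting back along the decoding.\<close>

lemma sub_blocks: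
  assumes B: "B \<in> triangles m" and f: "strict_mono_on {1..k} f"
    and fS: "\<And>i. i \<in> {1..k} \<Longrightarrow> f i \<in> {1..m} \<and> S i \<subseteq> level B (f i) \<and> card (S i) = i"
  shows triangles_in_of_blocks: "(\<Union>i\<in>{1..k}. S i) \<in> triangles_in k B"
    and level_of_sub_blocks: "\<And>i. i \<in> {1..k} \<Longrightarrow> level (\<Union>i\<in>{1..k}. S i) i = S i"
proof -
  have card: "card (S i) = i" if "i \<in> {1..k}" for i using fS that by blast
  have less: "x < y" if "1 \<le> i" "i < j" "j \<le> k" "x \<in> S i" "y \<in> S j" for i j x y
  proof (rule level_less[OF B])
    show "f i < f j" using f that by (auto simp: strict_mono_on_def)
    show "x \<in> level B (f i)" "y \<in> level B (f j)" "f j \<le> m"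
      using fS[of i] fS[of j] that by auto
  qed
  show lev: "\<And>i. i \<in> {1..k} \<Longrightarrow> level (\<Union>i\<in>{1..k}. S i) i = S i"
    by (rule level_of_blocks) (use card less in blast)+
  have "(\<Union>i\<in>{1..k}. S i) \<in> triangles k"
    by (rule triangle_of_blocks) (use card less in blast)+
  then show "(\<Union>i\<in>{1..k}. S i) \<in> triangles_in k B"
    unfolding triangles_in_iff[OF B] using f fS lev by blast
qed

text \<open>Every set \<open>J\<close> of \<open>k\<close> levels of \<open>Z\<close> carries a
  \<open>k\<close>-triangle that meets exactly the levels in \<open>J\<close>. The map
  \<open>G\<close>, which records the levels met, is therefore onto the \<open>k\<close>-subsets of
  the set of levels.\<close>

lemma card_triangles_in_ge:
  assumes Z: "Z \<in> triangles n"
  shows "n choose k \<le> card (triangles_in k Z)"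
proof -
  define G where "G = (\<lambda>W. {j \<in> {1..n}. W \<inter> level Z j \<noteq> {}})"
  have "J \<in> G ` triangles_in k Z" if J: "J \<subseteq> {1..n}" "card J = k" for J
  proof -
    define f where "f = (\<lambda>i. sorted_list_of_set J ! (i - 1))"
    have "finite J" using J(1) finite_subset by blast
    have f: "strict_mono_on {1..k} f"
      unfolding f_def using J(2) by (intro strict_mono_onI nth_sorted_list_of_set_less) auto
    have "{1..k} = Suc ` {..<k}"
      by (simp add: image_Suc_lessThan)
    then have "f ` {1..k} = (!) (sorted_list_of_set J) ` {..<card J}"
      unfolding f_def J(2) by (simp add: image_image)
    also have "\<dots> = J"
      using \<open>finite J\<close> by (rule set_nth_sorted_list_of_set)
    finally have fJ: "f ` {1..k} = J" .
    \<comment> \<open>The \<open>i\<close>-th smallest element of a set of positive integers is at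
      least \<open>i\<close>, so level \<open>f i\<close> of \<open>Z\<close> has room for
      \<open>i\<close> elements.\<close>
    have "i \<le> f i" if i: "i \<in> {1..k}" for i
    proof -
      have "f ` {1..i} \<subseteq> {1..f i}"
      proof
        fix y assume "y \<in> f ` {1..i}"
        then obtain x where x: "x \<in> {1..i}" "y = f x" by auto
        then have "x \<in> {1..k}" using i by auto
        then have "f x \<in> {1..n}" using fJ J(1) by blast
        moreover have "f x \<le> f i" using f x i by (cases "x = i") (auto simp: strict_mono_on_def intro: less_imp_le)
        ultimately show "y \<in> {1..f i}" using x by auto
      qed
      moreover have "inj_on f {1..i}"
        using strict_mono_on_imp_inj_on[OF f] i by (auto intro: inj_on_subset)
      ultimately show ?thesis
        using card_mono[of "{1..f i}" "f ` {1..i}"] by (simp add: card_image)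
    qed
    then have "\<exists>S. S \<subseteq> level Z (f i) \<and> card S = i" if "i \<in> {1..k}" for i
      using card_level[OF Z, of "f i"] that fJ J(1)
      by (metis obtain_subset_with_card_n atLeastAtMost_iff image_eqI subsetD)
    then obtain S where S: "\<And>i. i \<in> {1..k} \<Longrightarrow> S i \<subseteq> level Z (f i) \<and> card (S i) = i"
      by metis
    define W where "W = (\<Union>i\<in>{1..k}. S i)"
    have fS: "f i \<in> {1..n} \<and> S i \<subseteq> level Z (f i) \<and> card (S i) = i" if "i \<in> {1..k}" for i
      using S[OF that] fJ J(1) that by blast
    have "W \<in> triangles_in k Z"
      unfolding W_def by (rule triangles_in_of_blocks[OF Z f fS])
    moreover have "G W = J"
    proof
      show "J \<subseteq> G W"
      proof
        fix j assume "j \<in> J"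
        then obtain i where i: "i \<in> {1..k}" "j = f i" using fJ by auto
        then have "S i \<noteq> {}" using fS[of i] by auto
        then show "j \<in> G W" using fS[OF i(1)] i unfolding G_def W_def by blast
      qed
      show "G W \<subseteq> J"
      proof
        fix j assume "j \<in> G W"
        then obtain i x where i: "i \<in> {1..k}" "x \<in> S i" "x \<in> level Z j" "j \<in> {1..n}"
          unfolding G_def W_def by blast
        then have "x \<in> level Z (f i)" "f i \<in> {1..n}" using fS[of i] by auto
        \<comment> \<open>Distinct levels are disjoint: a common element would be less than
          itself.\<close>
        then have "j = f i"
          using level_less[OF Z, of j "f i" x x] level_less[OF Z, of "f i" j x x] i
          by (metis atLeastAtMost_iff less_irrefl nat_neq_iff)
        then show "j \<in> J" using fJ i by auto
      qed
    qed
    ultimately show ?thesis by blast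
  qed
  then have "{J. J \<subseteq> {1..n} \<and> card J = k} \<subseteq> G ` triangles_in k Z" by blast
  moreover have "finite (triangles_in k Z)"
    using Z triangles_in_subset by (auto simp: triangles_def intro: finite_subset)
  ultimately have "card {J. J \<subseteq> {1..n} \<and> card J = k} \<le> card (triangles_in k Z)"
    by (meson card_image_le card_mono finite_imageI le_trans)
  then show ?thesis by (simp add: n_subsets)
qed

section \<open>Finiteness of the Ramsey number\<close>

text \<open>The first element of level \<open>i + 1\<close> of a triangle \<open>A\<close> names a level of the board and
  the remaining \<open>i\<close> elements name places in it.\<close>
definition decode :: "(nat \<Rightarrow> nat \<Rightarrow> nat) \<Rightarrow> nat \<Rightarrow> nat set \<Rightarrow> nat set" where
  "decode b k A = (\<Union>i\<in>{1..k}.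
     b (Min (level A (i + 1))) ` (level A (i + 1) - {Min (level A (i + 1))}))"

text \<open>A name \<open>l\<close> stands for the board level \<open>g l\<close>, and a name
  \<open>e\<close> for the place \<open>b l e\<close> in it. Levels and places share the names below
  \<open>N\<close>, so that Ramsey's theorem can be applied to plain sets of numbers.\<close>

context
  fixes N m :: nat and B :: "nat set" and b :: "nat \<Rightarrow> nat \<Rightarrow> nat" and g :: "nat \<Rightarrow> nat"
  assumes B: "B \<in> triangles m"
    and g_mono: "strict_mono_on {..<N} g"
    and g: "\<And>l. l < N \<Longrightarrow> g l \<in> {1..m}"
    and b: "\<And>l e. l < N \<Longrightarrow> e < N \<Longrightarrow> b l e \<in> level B (g l)"
    and b_inj: "\<And>l. l < N \<Longrightarrow> inj_on (b l) {..<N}"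
begin

text \<open>The minima of the levels of \<open>A\<close> increase, so they name increasing board
  levels. Level \<open>i + 1\<close> has \<open>i\<close> elements besides its minimum, and
  injectivity of \<open>b\<close> keeps their number, as \<open>sub_blocks\<close> requires.\<close>

lemma
  assumes A: "A \<in> triangles (Suc k)" "A \<subseteq> {..<N}"
  shows decode_in: "decode b k A \<in> triangles_in k B"
    and level_decode: "\<And>i. i \<in> {1..k} \<Longrightarrow> level (decode b k A) i =
     b (Min (level A (i + 1))) ` (level A (i + 1) - {Min (level A (i + 1))})"
proof -
  define L where "L = (\<lambda>i. level A (i + 1))"
  define l where "l = (\<lambda>i. Min (L i))"
  have card: "card (L i) = i + 1" and sub: "L i \<subseteq> {..<N}" and l: "l i \<in> L i" if "i \<in> {1..k}" for i
  proof -
    show *: "card (L i) = i + 1"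
      using that unfolding L_def by (intro card_level[OF A(1)]) auto
    show "L i \<subseteq> {..<N}"
      using level_subset[OF A(1), of "i + 1"] that A(2) unfolding L_def by auto
    have "L i \<noteq> {}" "finite (L i)" using * card_ge_0_finite[of "L i"] by auto
    then show "l i \<in> L i" unfolding l_def by simp
  qed
  have mono: "strict_mono_on {1..k} (\<lambda>i. g (l i))"
  proof (rule strict_mono_onI)
    fix i j assume ij: "i \<in> {1..k}" "j \<in> {1..k}" "i < j"
    have "l i < l j"
    proof (rule level_less[OF A(1)])
      show "i + 1 < j + 1" "j + 1 \<le> Suc k" using ij by auto
      show "l i \<in> level A (i + 1)" "l j \<in> level A (j + 1)" using l ij L_def by auto
    qed
    moreover have "l i \<in> {..<N}" "l j \<in> {..<N}"
      using l sub ij by blast+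
    ultimately show "g (l i) < g (l j)"
      using g_mono unfolding strict_mono_on_def by blast
  qed
  have S: "g (l i) \<in> {1..m} \<and> b (l i) ` (L i - {l i}) \<subseteq> level B (g (l i)) \<and>
      card (b (l i) ` (L i - {l i})) = i"
    if i: "i \<in> {1..k}" for i
  proof -
    have lN: "l i < N" using l[OF i] sub[OF i] by auto
    have "inj_on (b (l i)) (L i - {l i})"
      by (rule inj_on_subset[OF b_inj[OF lN]]) (use sub[OF i] in auto)
    then have "card (b (l i) ` (L i - {l i})) = i"
      using card[OF i] l[OF i] by (simp add: card_image)
    moreover have "b (l i) ` (L i - {l i}) \<subseteq> level B (g (l i))"
      using b[OF lN] sub[OF i] by blast
    ultimately show ?thesis using g[OF lN] by blast
  qed
  show "decode b k A \<in> triangles_in k B"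
    using triangles_in_of_blocks[OF B mono S] unfolding decode_def l_def L_def by blast
  show "level (decode b k A) i = b (Min (level A (i + 1))) ` (level A (i + 1) - {Min (level A (i + 1))})"
    if "i \<in> {1..k}" for i
    using level_of_sub_blocks[OF B mono S that] unfolding decode_def l_def L_def .
qed

text \<open>Carries homogeneity of \<open>H\<close> over to all \<open>k\<close>-triangles of the
  decoded \<open>n\<close>-triangle. Each level of \<open>W\<close> is pulled back along
  \<open>b\<close> into a level of \<open>H\<close>, and the minimum of that level is adjoined to
  name the same board level.\<close>

lemma decode_cover:
  assumes H: "H \<in> triangles (Suc n)" "H \<subseteq> {..<N}"
    and W: "W \<in> triangles_in k (decode b n H)"
  obtains A where "A \<in> triangles (Suc k)" "A \<subseteq> H" "decode b k A = W"
proof -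
  have Z: "decode b n H \<in> triangles n"
    using decode_in[OF H] triangles_in_iff[OF B] by blast
  obtain f where WT: "W \<in> triangles k" and f: "strict_mono_on {1..k} f"
    "\<forall>i\<in>{1..k}. f i \<in> {1..n} \<and> level W i \<subseteq> level (decode b n H) (f i)"
    using W triangles_in_iff[OF Z] by blast
  define l where "l = (\<lambda>j. Min (level H (j + 1)))"
  have l: "l j \<in> level H (j + 1)" if "j \<in> {1..n}" for j
    using card_level[OF H(1), of "j + 1"] that unfolding l_def by (intro Min_in) auto
  have "\<exists>E. E \<subseteq> level H (f i + 1) - {l (f i)} \<and> level W i = b (l (f i)) ` E" if "i \<in> {1..k}" for i
    using f(2) that level_decode[OF H, of "f i"] unfolding l_def by (metis subset_imageE)
  then obtain E where E: "\<And>i. i \<in> {1..k} \<Longrightarrow>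
      E i \<subseteq> level H (f i + 1) - {l (f i)} \<and> level W i = b (l (f i)) ` E i"
    by metis
  have sub: "level H (f i + 1) \<subseteq> {..<N}" if "i \<in> {1..k}" for i
    using level_subset[OF H(1), of "f i + 1"] f(2) that H(2) by fastforce
  have fin: "finite (E i)" if "i \<in> {1..k}" for i
    using E[OF that] finite_subset[of "E i"] by auto
  have cardE: "card (E i) = i" if i: "i \<in> {1..k}" for i
  proof -
    have "l (f i) < N" using l[of "f i"] f(2) i sub[OF i] by auto
    then have "inj_on (b (l (f i))) (E i)"
      using b_inj E[OF i] sub[OF i] by (meson Diff_subset inj_on_subset subset_trans)
    then show ?thesis
      using E[OF i] card_level[OF WT, of i] i by (auto simp: card_image)
  qed
  \<comment> \<open>Level \<open>j\<close> of \<open>A\<close> codes level \<open>j - 1\<close> of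
    \<open>W\<close>, whence the shift in \<open>C\<close> and \<open>h\<close>. The one-element
    level 1 that \<open>A\<close> must have is taken from \<open>H\<close>.\<close>
  define C where "C = (\<lambda>j. if j = 1 then level H 1 else insert (l (f (j - 1))) (E (j - 1)))"
  define h where "h = (\<lambda>j. if j = 1 then 1 else f (j - 1) + 1)"
  have h: "strict_mono_on {1..Suc k} h"
  proof (rule strict_mono_onI)
    fix i j assume ij: "i \<in> {1..Suc k}" "j \<in> {1..Suc k}" "i < j"
    show "h i < h j"
    proof (cases "i = 1")
      case True
      then have "j - 1 \<in> {1..k}" using ij by auto
      then have "f (j - 1) \<ge> 1" using f(2) by fastforce
      then show ?thesis using True ij by (simp add: h_def)
    next
      case False
      then have "i - 1 \<in> {1..k}" "j - 1 \<in> {1..k}" "i - 1 < j - 1" using ij by auto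
      then have "f (i - 1) < f (j - 1)" using f(1) by (auto simp: strict_mono_on_def)
      then show ?thesis using False ij by (simp add: h_def)
    qed
  qed
  have hC: "h j \<in> {1..Suc n} \<and> C j \<subseteq> level H (h j) \<and> card (C j) = j" if j: "j \<in> {1..Suc k}" for j
  proof (cases "j = 1")
    case True
    then show ?thesis using card_level[OF H(1), of 1] by (simp add: h_def C_def)
  next
    case False
    then have j': "j - 1 \<in> {1..k}" using j by auto
    then have fj: "f (j - 1) \<in> {1..n}" using f(2) by blast
    have "l (f (j - 1)) \<notin> E (j - 1)" using E[OF j'] by blast
    then have "card (C j) = j"
      using False j fin[OF j'] cardE[OF j'] by (simp add: C_def)
    moreover have "C j \<subseteq> level H (h j)"
      using E[OF j'] l[OF fj] False by (auto simp: C_def h_def)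
    ultimately show ?thesis using fj False by (auto simp: h_def)
  qed
  define A where "A = (\<Union>j\<in>{1..Suc k}. C j)"
  have "A \<in> triangles_in (Suc k) H"
    unfolding A_def by (rule triangles_in_of_blocks[OF H(1) h hC])
  then have A: "A \<in> triangles (Suc k)" "A \<subseteq> H"
    using triangles_in_subset by (auto simp: triangles_in_def)
  have levA: "level A (i + 1) = insert (l (f i)) (E i)" if "i \<in> {1..k}" for i
    unfolding A_def using level_of_sub_blocks[OF H(1) h hC, of "i + 1"] that by (auto simp: C_def)
  have "b (Min (level A (i + 1))) ` (level A (i + 1) - {Min (level A (i + 1))}) = level W i"
    if i: "i \<in> {1..k}" for i
  proof -
    \<comment> \<open>The adjoined name is the minimum of the whole level of \<open>H\<close>, hence
      also of the smaller level of \<open>A\<close>, so decoding removes exactly this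
      element.\<close>
    have "l (f i) \<le> x" if "x \<in> E i" for x
      unfolding l_def using E[OF i] that by (intro Min_le) auto
    then have "Min (level A (i + 1)) = l (f i)"
      unfolding levA[OF i] using fin[OF i] by (intro Min_eqI) auto
    moreover have "l (f i) \<notin> E i" using E[OF i] by blast
    ultimately show ?thesis using E[OF i] levA[OF i] by auto
  qed
  then have "decode b k A = (\<Union>i\<in>{1..k}. level W i)"
    unfolding decode_def by (intro SUP_cong) auto
  then have "decode b k A = W" using Union_level[OF WT] by simp
  with A show ?thesis using that by blast
qed

end

text \<open>Ramsey's theorem with two colours, applied to the colour of the decoded triangle, on a
  board with \<open>2 * N\<close> levels. This shows that the \<open>LEAST\<close> in
  \<open>R1\<close> is attained.\<close>

lemma no_draw_exists:
  "\<exists>m\<ge>n. \<forall>B X Y. completed_game m k B X Y \<longrightarrow> \<not> draw n k B X Y"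
proof -
  obtain N :: nat where N: "partn_lst {..<N} [tri (Suc n), tri (Suc n)] (tri (Suc k))"
    using ramsey_full[of "[tri (Suc n), tri (Suc n)]" "tri (Suc k)"] by (elim exE)
  have mono: "\<exists>i<2. \<exists>H. H \<in> triangles (Suc n) \<and> H \<subseteq> {..<N} \<and>
      (\<forall>A. A \<in> triangles (Suc k) \<and> A \<subseteq> H \<longrightarrow> c A = i)" if c: "\<And>A. c A < 2" for c :: "nat set \<Rightarrow> nat"
  proof -
    obtain i H where "i < length [tri (Suc n), tri (Suc n)]"
      "H \<in> nsets {..<N} ([tri (Suc n), tri (Suc n)] ! i)" "c ` nsets H (tri (Suc k)) \<subseteq> {i}"
      by (rule partn_lstE[OF N, of c 2]) (use c in auto)
    moreover from this have "[tri (Suc n), tri (Suc n)] ! i = tri (Suc n)"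
      by (auto simp: less_Suc_eq)
    ultimately show ?thesis
      by (intro exI[of _ i] conjI exI[of _ H]) (auto simp: nsets_def triangles_def)
  qed
  \<comment> \<open>Even a constant colouring yields a subset of size \<open>tri (Suc n)\<close>
    below \<open>N\<close>, which forces \<open>n \<le> N\<close>.\<close>
  obtain H where "card H = tri (Suc n)" "H \<subseteq> {..<N}"
    using mono[of "\<lambda>_. 0"] by (auto simp: triangles_def)
  then have "n \<le> N"
    using card_mono[of "{..<N}" H] le_tri[of "Suc n"] by auto
  have "\<not> draw n k B X Y" if game: "completed_game (2 * N) k B X Y" for B X Y
  proof -
    have B: "B \<in> triangles (2 * N)" and XY: "X \<union> Y = triangles_in k B"
      using game by (auto simp: completed_game_def)
    \<comment> \<open>The upper half of the board is used: level \<open>N + l + 1\<close> starts at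
      list position \<open>tri (N + l)\<close> and has more than \<open>N\<close> elements, enough
      for all places below \<open>N\<close>.\<close>
    define b where "b = (\<lambda>l e. sorted_list_of_set B ! (tri (N + l) + e))"
    define g where "g = (\<lambda>l. N + l + 1)"
    have g: "strict_mono_on {..<N} g" "\<And>l. l < N \<Longrightarrow> g l \<in> {1..2 * N}"
      by (auto simp: g_def strict_mono_on_def)
    have b: "b l e \<in> level B (g l)" if "l < N" "e < N" for l e
      using that unfolding b_def g_def level_def by (auto simp: tri_Suc)
    have b_inj: "inj_on (b l) {..<N}" if "l < N" for l
    proof -
      have "tri (N + l) + e < card B" if "e < N" for e
        using B tri_mono[of "Suc (N + l)" "2 * N"] \<open>l < N\<close> that by (auto simp: triangles_def tri_Suc)
      then show ?thesis by (auto simp: inj_on_def b_def nth_eq_iff_index_eq)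
    qed
    note decode = decode_in[OF B g b b_inj] decode_cover[OF B g b b_inj]
    define c :: "nat set \<Rightarrow> nat" where "c = (\<lambda>W. if W \<in> X then 0 else 1)"
    have "\<And>A. c (decode b k A) < 2" by (simp add: c_def)
    then obtain i H where H: "H \<in> triangles (Suc n)" "H \<subseteq> {..<N}"
      and i: "\<And>A. A \<in> triangles (Suc k) \<Longrightarrow> A \<subseteq> H \<Longrightarrow> c (decode b k A) = i"
      using mono[of "\<lambda>A. c (decode b k A)"] by blast
    define Z where "Z = decode b n H"
    have Z: "Z \<in> triangles_in n B" unfolding Z_def using decode(1) H by blast
    have "c W = i" if "W \<in> triangles_in k Z" for W
      using decode(2)[OF _ _ _ _ H] that i unfolding Z_def by metis
    then have "triangles_in k Z \<subseteq> X \<or> triangles_in k Z \<inter> X = {}"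
      unfolding c_def by (metis disjoint_iff subsetI zero_neq_one)
    moreover have "triangles_in k Z \<subseteq> X \<union> Y"
      unfolding XY using triangles_in_trans[OF B Z] by blast
    ultimately show ?thesis using Z unfolding draw_def by blast
  qed
  then show ?thesis using \<open>n \<le> N\<close> by (intro exI[of _ "2 * N"]) auto
qed

section \<open>Counting monochromatic colourings\<close>

text \<open>Such an \<open>X\<close> is determined by its part outside \<open>K\<close> and the
  choice between containing and avoiding \<open>K\<close>. The lower bound \<open>c\<close> on
  \<open>card K\<close> gives one estimate for all \<open>n\<close>-triangles at once.\<close>

lemma card_monochromatic_le:
  fixes D K :: "'a set"
  assumes "finite D" "K \<subseteq> D" "c \<le> card K"
  shows "card {X. X \<subseteq> D \<and> (K \<subseteq> X \<or> K \<inter> X = {})} \<le> 2 * 2 ^ (card D - c)"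
proof -
  have fin: "finite (D - K)" using assms by simp
  have "{X. X \<subseteq> D \<and> (K \<subseteq> X \<or> K \<inter> X = {})} \<subseteq> (\<lambda>U. U \<union> K) ` Pow (D - K) \<union> Pow (D - K)"
  proof
    fix X assume "X \<in> {X. X \<subseteq> D \<and> (K \<subseteq> X \<or> K \<inter> X = {})}"
    then consider "X = (X - K) \<union> K" "X - K \<in> Pow (D - K)" | "X \<in> Pow (D - K)" by blast
    then show "X \<in> (\<lambda>U. U \<union> K) ` Pow (D - K) \<union> Pow (D - K)" by cases blast+
  qed
  then have "card {X. X \<subseteq> D \<and> (K \<subseteq> X \<or> K \<inter> X = {})}
      \<le> card ((\<lambda>U. U \<union> K) ` Pow (D - K) \<union> Pow (D - K))"
    using fin by (intro card_mono) auto
  also have "\<dots> \<le> card (Pow (D - K)) + card (Pow (D - K))"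
    using fin by (intro order.trans[OF card_Un_le] add_mono card_image_le) auto
  also have "\<dots> = 2 * 2 ^ (card D - card K)"
    using assms fin by (simp add: card_Pow card_Diff_subset finite_subset)
  also have "\<dots> \<le> 2 * 2 ^ (card D - c)"
    using assms(3) by (simp add: power_increasing)
  finally show ?thesis .
qed

text \<open>A union bound on the board of the first \<open>tri m\<close> numbers: every colouring
  \<open>X\<close> lies in some \<open>M Z\<close>. Finally the \<open>n\<close>-triangles are
  counted among all \<open>tri n\<close>-subsets of the board.\<close>

lemma no_draw_count:
  assumes "\<And>B X Y. completed_game m k B X Y \<Longrightarrow> \<not> draw n k B X Y"
  shows "2 ^ (n choose k) \<le> 2 * (tri m choose tri n)"
proof -
  define B where "B = {..<tri m}"
  have B: "B \<in> triangles m" by (simp add: B_def triangles_def)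
  define D where "D = triangles_in k B"
  define T where "T = triangles_in n B"
  define M where "M = (\<lambda>Z. {X. X \<subseteq> D \<and> (triangles_in k Z \<subseteq> X \<or> triangles_in k Z \<inter> X = {})})"
  have finB: "finite (Pow B)" by (simp add: B_def)
  have fin: "finite D" "finite T"
    unfolding D_def T_def using triangles_in_subset finB by (auto intro: finite_subset)
  have sub: "triangles_in k Z \<subseteq> D" and ge: "n choose k \<le> card (triangles_in k Z)" if "Z \<in> T" for Z
    using triangles_in_trans[OF B] that card_triangles_in_ge triangles_in_iff[OF B]
    unfolding D_def T_def by blast+
  have "Pow D \<subseteq> (\<Union>Z\<in>T. M Z)"
  proof
    fix X assume "X \<in> Pow D"
    then have "completed_game m k B X (D - X)"
      using B by (auto simp: completed_game_def D_def)
    then obtain Z where "Z \<in> T" "triangles_in k Z \<subseteq> X \<or> triangles_in k Z \<subseteq> D - X"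
      using assms unfolding draw_def T_def by blast
    then show "X \<in> (\<Union>Z\<in>T. M Z)" using \<open>X \<in> Pow D\<close> unfolding M_def by blast
  qed
  moreover have "finite (M Z)" for Z unfolding M_def using fin by simp
  ultimately have "card (Pow D) \<le> card (\<Union>Z\<in>T. M Z)"
    using fin by (intro card_mono) auto
  also have "\<dots> \<le> (\<Sum>Z\<in>T. card (M Z))" by (rule card_UN_le[OF fin(2)])
  also have "\<dots> \<le> (\<Sum>Z\<in>T. 2 * 2 ^ (card D - (n choose k)))"
    unfolding M_def by (intro sum_mono card_monochromatic_le fin sub ge)
  finally have *: "2 ^ card D \<le> card T * (2 * 2 ^ (card D - (n choose k)))"
    using fin by (simp add: card_Pow)
  \<comment> \<open>An existing \<open>n\<close>-triangle provides enough \<open>k\<close>-triangles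
    in \<open>D\<close> to make the truncated subtraction in the exponent genuine, so that the
    common power of 2 cancels.\<close>
  then have "T \<noteq> {}" by auto
  then have "n choose k \<le> card D"
    using sub ge card_mono[OF fin(1)] by (meson all_not_in_conv le_trans)
  then have "2 ^ card D = 2 ^ (n choose k) * (2::nat) ^ (card D - (n choose k))"
    by (simp flip: power_add)
  with * have "2 ^ (n choose k) * (2::nat) ^ (card D - (n choose k)) \<le> 2 * card T * 2 ^ (card D - (n choose k))"
    by (simp add: mult_ac)
  then have "2 ^ (n choose k) \<le> 2 * card T" by simp
  also have "T \<subseteq> {Z. Z \<subseteq> B \<and> card Z = tri n}"
    using triangles_in_subset[of n B] by (auto simp: T_def triangles_in_def triangles_def)
  then have "card T \<le> card {Z. Z \<subseteq> B \<and> card Z = tri n}"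
    by (intro card_mono) (auto simp: B_def)
  then have "2 * card T \<le> 2 * (tri m choose tri n)"
    by (simp add: n_subsets B_def)
  finally show ?thesis .
qed

section \<open>From the count to the closed form\<close>

theorem theorem10:
  fixes n k m :: nat
  assumes "k \<le> n"
    and "m = R1 n k"
  shows "real m >
    (2 * pi * real (tri n)) powr (1 / (4 * real (tri n)))
      * sqrt (2 * real (tri n) / exp 1)
      * 2 powr ((real n ^ k - real k ^ k) / (2 * real k ^ k * real (tri n)))
      - 1"
proof (cases "n = 0")
  \<comment> \<open>Here \<open>tri n = 0\<close>, so the square root vanishes and the right-hand
    side is -1.\<close>
  case True
  then show ?thesis by simp
next
  case False
  have "n \<le> m \<and> (\<forall>B X Y. completed_game m k B X Y \<longrightarrow> \<not> draw n k B X Y)"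
    unfolding assms(2) R1_def by (rule LeastI_ex) (use no_draw_exists in blast)
  then have "n \<le> m" and count: "2 ^ (n choose k) \<le> 2 * (tri m choose tri n)"
    using no_draw_count by blast+
  define T where "T = real (tri n)"
  define M where "M = real (tri m)"
  \<comment> \<open>\<open>P\<close> is \<open>(n/k)^k - 1\<close>, with \<open>0^0 = 1\<close>
    covering \<open>k = 0\<close>; the claimed power of 2 has exponent \<open>P / (2 * T)\<close>.
    The -1 pays for the factor 2 in \<open>count\<close>, which stands for the two colours.\<close>
  define P where "P = (real n ^ k - real k ^ k) / real k ^ k"
  define R where "R = (2 * pi * T) powr (1 / (4 * T)) * sqrt (2 * T / exp 1) *
    2 powr ((real n ^ k - real k ^ k) / (2 * real k ^ k * T))"
  have T: "T > 0" using False le_tri[of n] by (simp add: T_def)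
  have M: "M > 0" using False \<open>n \<le> m\<close> le_tri[of m] by (simp add: M_def)
  have kk: "real k ^ k > 0" by (cases "k = 0") auto
  have "P = (real n / real k) ^ k - 1"
    using kk by (simp add: P_def power_divide diff_divide_distrib)
  also have "\<dots> \<le> real (n choose k) - 1"
    using binomial_ge_n_over_k_pow_k[OF assms(1), where 'a = real] by simp
  finally have P: "P \<le> real (n choose k) - 1" .
  \<comment> \<open>Stirling's bound is multiplied by \<open>count\<close>, so that the factorial
    turns the binomial coefficient into a falling factorial, which is at most
    \<open>M ^ tri n\<close>.\<close>
  have "sqrt (2 * pi * T) * (T / exp 1) ^ tri n * 2 ^ (n choose k)
      \<le> fact (tri n) * (2 * real (tri m choose tri n))"
  proof (intro mult_mono)
    show "sqrt (2 * pi * T) * (T / exp 1) ^ tri n \<le> fact (tri n)"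
      unfolding T_def by (rule stirling_lower_bound)
    show "2 ^ (n choose k) \<le> 2 * real (tri m choose tri n)"
      using count by (metis of_nat_le_iff of_nat_mult of_nat_numeral of_nat_power)
  qed auto
  also have "\<dots> = 2 * real ((tri m choose tri n) * fact (tri n))"
    by simp
  also have "\<dots> \<le> 2 * M ^ tri n"
    unfolding M_def using binomial_fact_pow[of "tri m" "tri n"]
    by (metis mult_left_mono of_nat_le_iff of_nat_power zero_le_numeral)
  finally have "ln (sqrt (2 * pi * T) * (T / exp 1) ^ tri n * 2 ^ (n choose k)) \<le> ln (2 * M ^ tri n)"
    using T M by (subst ln_le_cancel_iff) auto
  then have "ln (2 * pi * T) / 2 + T * (ln T - 1) + (real (n choose k) - 1) * ln 2 \<le> T * ln M"
    using T M by (simp add: ln_mult ln_div ln_realpow ln_sqrt T_def algebra_simps)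
  moreover have "P * ln 2 \<le> (real (n choose k) - 1) * ln 2"
    using P by (intro mult_right_mono) auto
  moreover have "ln R = ln (2 * pi * T) / (4 * T) + (ln (2 * T) - 1) / 2 + P / (2 * T) * ln 2"
    unfolding R_def P_def using T by (simp add: ln_mult ln_div ln_sqrt ln_powr)
  \<comment> \<open>Scaling by \<open>2 * T\<close> makes the terms match the logarithm of the
    counting inequality, up to \<open>T * ln 2\<close>, which turns \<open>ln M\<close> into
    \<open>ln (2 * M)\<close>.\<close>
  then have "2 * T * ln R = ln (2 * pi * T) / 2 + T * (ln 2 + ln T - 1) + P * ln 2"
    using T by (simp add: field_simps ln_mult)
  ultimately have "2 * T * ln R \<le> T * (ln 2 + ln M)"
    by (simp add: algebra_simps)
  also have "\<dots> = T * ln (2 * M)" using M by (simp add: ln_mult)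
  also have "2 * M = real m * (real m + 1)"
    unfolding M_def using arg_cong[OF two_tri[of m], of real] by (simp add: algebra_simps)
  \<comment> \<open>The only strict step of the chain; it makes the final inequality strict.\<close>
  also have "T * ln (real m * (real m + 1)) < T * ln ((real m + 1) * (real m + 1))"
    using T False \<open>n \<le> m\<close> by (intro mult_strict_left_mono) auto
  also have "\<dots> = 2 * T * ln (real m + 1)"
    by (simp add: ln_mult)
  finally have "ln R < ln (real m + 1)"
    using T by simp
  moreover have "R > 0" using T by (simp add: R_def)
  ultimately have "R < real m + 1" by simp
  then show ?thesis unfolding R_def T_def by simp
qed

end
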